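(* Let $(\Omega, \mu)$ be a $\sigma$-finite measure space. Let $\phi \colon \Omega \to \mathbb{C}$ be measurable with essential range contained in the closed unit disc $\{\lambda\in\mathbb{C}: |\lambda|\le 1\}$. Let $1 \leq q \leq p < \infty$, and let $T$ be the multiplication operator induced by $\phi$ on $L^q(\Omega,\mu)$, i.e., $Tx = \phi x$ for $x \in L^q(\Omega,\mu)$. Let $\alpha \in (0,1)$. Then the following statements are equivalent: (i) $\|T^n(I-T)\| = O(n^{-\alpha})$ as $n \to \infty$. (ii) There exists a constant $C>0$ such that $$\sum_{n=1}^{\infty} n^{\alpha p-1} \|T^n (I-T)x\|^p \leq C \|x\|^p$$ for all $x \in L^q(\Omega,\mu)$.
   Context: $L^q(\Omega,\mu)$ is the space of complex-valued $q$-integrable functions. $a(n) = O(b(n))$ as $n\to\infty$ means there are constants $K>0$, $n_0$ with $a(n)\le K b(n)$ for all $n \ge n_0$. *)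

theory Defs
  imports "HOL-Analysis.Analysis" "HOL-Library.Landau_Symbols"
begin

text \<open>
  The space \<open>L\<^sup>q(M)\<close> is represented by the functions themselves rather than by
  their classes modulo almost-everywhere equality, so \<open>Lq_norm\<close> is a seminorm vanishing exactly
  on the null functions.
\<close>

definition Lq_space :: "'a measure \<Rightarrow> real \<Rightarrow> ('a \<Rightarrow> complex) set" where
  "Lq_space M q =
     {f \<in> borel_measurable M. integrable M (\<lambda>\<omega>. norm (f \<omega>) powr q)}"

definition Lq_norm :: "'a measure \<Rightarrow> real \<Rightarrow> ('a \<Rightarrow> complex) \<Rightarrow> real" where
  "Lq_norm M q f = (\<integral>\<omega>. norm (f \<omega>) powr q \<partial>M) powr (1 / q)"

text \<open>
  The analogue of \<^const>\<open>onorm\<close> for operators on \<open>L\<^sup>q(M)\<close>; null functions contribute \<open>0\<close>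
  since \<open>x / 0 = 0\<close>. As for \<^const>\<open>onorm\<close>, the value is meaningful only if the quotients are bounded.
\<close>

definition Lq_onorm ::
  "'a measure \<Rightarrow> real \<Rightarrow> (('a \<Rightarrow> complex) \<Rightarrow> ('a \<Rightarrow> complex)) \<Rightarrow> real" where
  "Lq_onorm M q S = (SUP f\<in>Lq_space M q. Lq_norm M q (S f) / Lq_norm M q f)"

definition ess_range :: "'a measure \<Rightarrow> ('a \<Rightarrow> complex) \<Rightarrow> complex set" where
  "ess_range M \<phi> =
     {z. \<forall>\<epsilon>>0. emeasure M {\<omega> \<in> space M. dist (\<phi> \<omega>) z < \<epsilon>} > 0}"

definition mult_op :: "('a \<Rightarrow> complex) \<Rightarrow> ('a \<Rightarrow> complex) \<Rightarrow> ('a \<Rightarrow> complex)" where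
  "mult_op \<phi> f = (\<lambda>\<omega>. \<phi> \<omega> * f \<omega>)"

end

theory Submission
  imports Defs "HOL-Real_Asymp.Real_Asymp"
begin

text \<open>
  Testing multiplication operators on weighted indicators shows that (i) says exactly
  \<open>|\<phi>|^n |1 - \<phi>| \<le> K (n + 1) powr (-\<alpha>)\<close> almost everywhere, and taking
  \<open>n \<approx> 1 / (1 - |\<phi>|)\<close> turns this into \<open>|1 - \<phi>| \<le> K' (1 - |\<phi>|) powr \<alpha>\<close>. Since
  \<open>\<Sum>n. n powr (\<beta> - 1) r^n\<close> is \<open>O((1 - r) powr (-\<beta>))\<close>, the sum in (ii) is bounded pointwise,
  and Jensen's inequality with exponent \<open>p / q \<ge> 1\<close> for the measure \<open>|x| powr q d\<mu>\<close> carries the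
  bound over to the norms. For (ii) \<open>\<Longrightarrow>\<close> (i), \<open>\<parallel>T^n (I - T) x\<parallel>\<close> is decreasing in \<open>n\<close>, so the first
  \<open>N\<close> terms of the sum dominate a multiple of \<open>N powr (\<alpha> p) \<parallel>T^N (I - T) x\<parallel> powr p\<close>.
\<close>

section \<open>Power weights on sequences and power series\<close>

lemma bigo_sequentially_iff:
  fixes f g :: "nat \<Rightarrow> real"
  assumes "\<And>n. g n \<noteq> 0"
  shows "f \<in> O(g) \<longleftrightarrow> (\<exists>K>0. \<forall>n. \<bar>f n\<bar> \<le> K * \<bar>g n\<bar>)"
proof
  assume "f \<in> O(g)"
  then obtain c where "eventually (\<lambda>n. norm (f n) \<le> c * norm (g n)) sequentially"
    by (rule landau_o.bigE)
  then have "eventually (\<lambda>n. norm (f n / g n) \<le> c) sequentially"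
    by eventually_elim (use assms in \<open>simp add: divide_le_eq\<close>)
  then have "Bseq (\<lambda>n. f n / g n)"
    by (rule BfunI)
  then obtain K where "K > 0" "\<And>n. norm (f n / g n) \<le> K"
    by (auto elim: BseqE)
  then show "\<exists>K>0. \<forall>n. \<bar>f n\<bar> \<le> K * \<bar>g n\<bar>"
    using assms by (auto simp: divide_le_eq)
next
  assume "\<exists>K>0. \<forall>n. \<bar>f n\<bar> \<le> K * \<bar>g n\<bar>"
  then obtain K where "\<And>n. \<bar>f n\<bar> \<le> K * \<bar>g n\<bar>"
    by blast
  then show "f \<in> O(g)"
    by (intro bigoI[of _ K] always_eventually) simp
qed

text \<open>
  The right-hand side is the \<open>n\<close>-th Taylor coefficient of \<open>(1 - r) powr (-\<beta>)\<close>; the quotient tends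
  to \<open>Gamma \<beta>\<close>.
\<close>

lemma powr_bigo_pochhammer_div_fact:
  fixes \<beta> :: real
  assumes "\<beta> > 0"
  shows "(\<lambda>n. real n powr (\<beta> - 1)) \<in> O(\<lambda>n. pochhammer \<beta> n / fact n)"
proof (rule bigoI_tendsto)
  have "(\<lambda>n. inverse ((- \<beta> gchoose n) / ((-1) ^ n / exp ((- \<beta> + 1) * ln (real n))))) \<longlonglongrightarrow> Gamma \<beta>"
    using tendsto_inverse[OF gbinomial_asymptotic[of "- \<beta>"]] Gamma_real_pos[OF assms] by simp
  moreover have "eventually (\<lambda>n. inverse ((- \<beta> gchoose n) / ((-1) ^ n / exp ((- \<beta> + 1) * ln (real n))))
      = real n powr (\<beta> - 1) / (pochhammer \<beta> n / fact n)) sequentially"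
    using eventually_gt_at_top[of 0]
  proof eventually_elim
    case (elim n)
    have "exp ((- \<beta> + 1) * ln (real n)) = inverse (real n powr (\<beta> - 1))"
      using elim by (simp add: powr_def algebra_simps flip: exp_minus)
    then show ?case
      by (simp add: gbinomial_pochhammer field_simps)
  qed
  ultimately show "(\<lambda>n. real n powr (\<beta> - 1) / (pochhammer \<beta> n / fact n)) \<longlonglongrightarrow> Gamma \<beta>"
    by (rule Lim_transform_eventually)
  show "eventually (\<lambda>n. pochhammer \<beta> n / fact n \<noteq> 0) sequentially"
    using pochhammer_pos[OF assms] by (simp add: less_le)
qed

lemma pochhammer_binomial_series:
  fixes \<beta> r :: real
  assumes "\<bar>r\<bar> < 1"
  shows "(\<lambda>n. pochhammer \<beta> n / fact n * r ^ n) sums (1 - r) powr (- \<beta>)"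
proof -
  have "(- \<beta> gchoose n) * (- r) ^ n = pochhammer \<beta> n / fact n * r ^ n" for n
    by (simp add: gbinomial_pochhammer power_minus[of r])
  then show ?thesis
    using gen_binomial_real[of "- r" "- \<beta>"] assms by simp
qed

lemma suminf_powr_mult_power_le:
  fixes \<beta> :: real
  assumes "\<beta> > 0"
  obtains C where "C > 0" and "\<And>r. 0 \<le> r \<Longrightarrow> r < 1 \<Longrightarrow>
    (\<Sum>n. ennreal (real (Suc n) powr (\<beta> - 1) * r ^ Suc n)) \<le> ennreal (C * (1 - r) powr (- \<beta>))"
proof -
  have coeff_pos: "pochhammer \<beta> n / fact n > 0" for n
    using assms by (simp add: pochhammer_pos)
  obtain C where C_pos: "C > 0" and "\<And>n. \<bar>real n powr (\<beta> - 1)\<bar> \<le> C * \<bar>pochhammer \<beta> n / fact n\<bar>"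
    using powr_bigo_pochhammer_div_fact[OF assms] coeff_pos
    by (subst (asm) bigo_sequentially_iff) (auto simp: less_le)
  then have coeff_le: "real n powr (\<beta> - 1) \<le> C * (pochhammer \<beta> n / fact n)" for n
    using coeff_pos[of n] by (metis abs_of_nonneg abs_of_pos powr_ge_zero)
  show ?thesis
  proof (rule that[OF C_pos])
    fix r :: real assume r_range: "0 \<le> r" "r < 1"
    define a where "a n = C * (pochhammer \<beta> n / fact n * r ^ n)" for n
    have "(\<Sum>n. ennreal (real (Suc n) powr (\<beta> - 1) * r ^ Suc n)) \<le> (\<Sum>n. ennreal (a (Suc n)))"
    proof (intro suminf_le ennreal_leI)
      show "real (Suc n) powr (\<beta> - 1) * r ^ Suc n \<le> a (Suc n)" for n
        using mult_right_mono[OF coeff_le[of "Suc n"], of "r ^ Suc n"] r_range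
        by (simp only: a_def mult.assoc zero_le_power)
    qed auto
    also have "\<dots> \<le> (\<Sum>n. ennreal (a n))"
      by (subst (2) suminf_offset[of _ 1]) auto
    also have "\<dots> = ennreal (C * (1 - r) powr (- \<beta>))"
    proof (rule suminf_ennreal_eq)
      show "0 \<le> a n" for n
        using C_pos r_range assms by (simp add: a_def pochhammer_nonneg)
      show "a sums (C * (1 - r) powr (- \<beta>))"
        unfolding a_def using r_range by (intro sums_mult pochhammer_binomial_series) auto
    qed
    finally show "(\<Sum>n. ennreal (real (Suc n) powr (\<beta> - 1) * r ^ Suc n))
      \<le> ennreal (C * (1 - r) powr (- \<beta>))" .
  qed
qed

lemma le_powr_of_power_mult_le_powr:
  fixes r d K \<alpha> :: real
  assumes "0 < \<alpha>" "0 \<le> r" "r \<le> 1" "0 \<le> d"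
    and decay: "\<And>n. r ^ n * d \<le> K * real (Suc n) powr (- \<alpha>)"
  shows "d \<le> 2 powr (\<alpha> + 1) * K * (1 - r) powr \<alpha>"
proof (cases "r = 1")
  case True
  have "(\<lambda>n. K * real (Suc n) powr (- \<alpha>)) \<longlonglongrightarrow> 0"
    using \<open>0 < \<alpha>\<close> by real_asymp
  then have "d \<le> 0"
    by (rule LIMSEQ_le_const) (use decay True in auto)
  then show ?thesis
    using True by simp
next
  case False
  define y where "y = 1 / (2 * (1 - r))"
  define N where "N = nat \<lfloor>y\<rfloor>"
  have "r < 1" and "0 < y"
    using False assms by (auto simp: y_def)
  then have N_bounds: "real N \<le> y" "y \<le> real (Suc N)"
    unfolding N_def by linarith+
  have "K \<ge> 0"
    using decay[of 0] \<open>0 \<le> d\<close> by simp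
  have "real N * (1 - r) \<le> 1 / 2"
    using N_bounds(1) \<open>r < 1\<close> by (simp add: y_def field_simps)
  then have "1 / 2 \<le> 1 + real N * (r - 1)"
    by (simp add: algebra_simps)
  also have "\<dots> \<le> r ^ N"
    using Bernoulli_inequality[of "r - 1" N] \<open>0 \<le> r\<close> by simp
  finally have "1 / 2 * d \<le> r ^ N * d"
    using \<open>0 \<le> d\<close> by (rule mult_right_mono)
  also have "\<dots> \<le> K * real (Suc N) powr (- \<alpha>)"
    by (rule decay)
  also have "\<dots> \<le> K * y powr (- \<alpha>)"
    using N_bounds \<open>0 < y\<close> \<open>0 < \<alpha>\<close> \<open>K \<ge> 0\<close> by (intro mult_left_mono powr_mono2') auto
  also have "y powr (- \<alpha>) = 2 powr \<alpha> * (1 - r) powr \<alpha>"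
    using \<open>r < 1\<close> by (simp add: y_def powr_minus powr_divide algebra_simps flip: powr_mult)
  finally show ?thesis
    by (simp add: powr_add mult_ac)
qed

lemma power_mult_powr_le:
  fixes r d p :: real
  assumes "0 \<le> r" "r \<le> 1" "1 \<le> p"
  shows "(r ^ n * d) powr p \<le> r ^ n * d powr p"
proof -
  have "(r ^ n) powr p \<le> r ^ n"
    using powr_mono'[of 1 p "r ^ n"] assms by (simp add: power_le_one)
  then show ?thesis
    by (simp only: powr_mult mult_right_mono powr_ge_zero)
qed

lemma suminf_powr_mult_power_powr_le:
  fixes \<alpha> p :: real
  assumes "0 < \<alpha>" "1 \<le> p"
  obtains C where "C > 0"
    and "\<And>r d K. \<lbrakk>0 \<le> r; r \<le> 1; 0 \<le> d; d \<le> K * (1 - r) powr \<alpha>\<rbrakk> \<Longrightarrow>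
      (\<Sum>n. ennreal (real (Suc n) powr (\<alpha> * p - 1) * (r ^ Suc n * d) powr p)) \<le> ennreal (C * K powr p)"
proof -
  obtain C where C_pos: "C > 0" and sum_le: "\<And>r. 0 \<le> r \<Longrightarrow> r < 1 \<Longrightarrow>
      (\<Sum>n. ennreal (real (Suc n) powr (\<alpha> * p - 1) * r ^ Suc n)) \<le> ennreal (C * (1 - r) powr (- (\<alpha> * p)))"
    by (rule suminf_powr_mult_power_le[of "\<alpha> * p"]) (use assms in auto)
  show ?thesis
  proof (rule that[OF C_pos])
    fix r d K :: real
    assume r_range: "0 \<le> r" "r \<le> 1" and d_bounds: "0 \<le> d" "d \<le> K * (1 - r) powr \<alpha>"
    show "(\<Sum>n. ennreal (real (Suc n) powr (\<alpha> * p - 1) * (r ^ Suc n * d) powr p)) \<le> ennreal (C * K powr p)"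
    proof (cases "r = 1")
      case True
      then show ?thesis
        using d_bounds by simp
    next
      case False
      have "(\<Sum>n. ennreal (real (Suc n) powr (\<alpha> * p - 1) * (r ^ Suc n * d) powr p))
          \<le> (\<Sum>n. ennreal (real (Suc n) powr (\<alpha> * p - 1) * r ^ Suc n) * ennreal (d powr p))"
        using r_range power_mult_powr_le[OF r_range \<open>1 \<le> p\<close>]
        by (intro suminf_le) (auto simp: mult.assoc intro!: ennreal_leI mult_left_mono
            simp flip: ennreal_mult' simp del: power_Suc)
      also have "\<dots> = (\<Sum>n. ennreal (real (Suc n) powr (\<alpha> * p - 1) * r ^ Suc n)) * ennreal (d powr p)"
        by (rule ennreal_suminf_multc)
      also have "\<dots> \<le> ennreal (C * (1 - r) powr (- (\<alpha> * p))) * ennreal ((K * (1 - r) powr \<alpha>) powr p)"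
        using r_range False d_bounds \<open>1 \<le> p\<close> by (intro mult_mono sum_le ennreal_leI powr_mono2) auto
      also have "\<dots> = ennreal (C * K powr p)"
        using r_range False C_pos by (simp add: powr_mult powr_powr powr_minus field_simps flip: ennreal_mult')
      finally show ?thesis .
    qed
  qed
qed

text \<open>Only the block \<open>N / 2 \<le> n \<le> N\<close> is needed; there \<open>n powr (\<beta> - 1) \<ge> (N / 2) powr \<beta> / N\<close>.\<close>

lemma sum_powr_ge:
  fixes \<beta> :: real
  assumes "\<beta> > 0"
  shows "real N powr \<beta> \<le> 2 powr (\<beta> + 1) * (\<Sum>n<N. real (Suc n) powr (\<beta> - 1))"
proof (cases "N = 0")
  case False
  have "real N powr \<beta> = 2 powr (\<beta> + 1) * ((real N / 2) * ((real N / 2) powr \<beta> / real N))"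
    using False by (simp add: powr_divide powr_add)
  also have "\<dots> \<le> 2 powr (\<beta> + 1) * (real (card {N div 2..<N}) * ((real N / 2) powr \<beta> / real N))"
    by (intro mult_left_mono mult_right_mono) auto
  also have "real (card {N div 2..<N}) * ((real N / 2) powr \<beta> / real N)
      = (\<Sum>n\<in>{N div 2..<N}. (real N / 2) powr \<beta> / real N)"
    by simp
  also have "2 powr (\<beta> + 1) * \<dots> \<le> 2 powr (\<beta> + 1) * (\<Sum>n\<in>{N div 2..<N}. real (Suc n) powr (\<beta> - 1))"
  proof (intro mult_left_mono sum_mono)
    fix n assume n_in_block: "n \<in> {N div 2..<N}"
    then have "real N / 2 \<le> real (Suc n)" by auto
    then have "(real N / 2) powr \<beta> / real N \<le> real (Suc n) powr \<beta> / real (Suc n)"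
      using n_in_block assms by (intro frac_le powr_mono2) auto
    then show "(real N / 2) powr \<beta> / real N \<le> real (Suc n) powr (\<beta> - 1)"
      by (simp add: powr_diff)
  qed auto
  also have "\<dots> \<le> 2 powr (\<beta> + 1) * (\<Sum>n<N. real (Suc n) powr (\<beta> - 1))"
    by (intro mult_left_mono sum_mono2) auto
  finally show ?thesis .
qed simp

lemma decseq_powr_mult_le_of_suminf_le:
  fixes b :: "nat \<Rightarrow> real"
  assumes "0 < \<beta>" "decseq b" and nonneg: "\<And>n. 0 \<le> b n" "0 \<le> S"
    and suminf_le: "(\<Sum>n. ennreal (real (Suc n) powr (\<beta> - 1) * b (Suc n))) \<le> ennreal S"
  shows "real N powr \<beta> * b N \<le> 2 powr (\<beta> + 1) * S"
proof -
  have "ennreal ((\<Sum>n<N. real (Suc n) powr (\<beta> - 1)) * b N)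
      = (\<Sum>n<N. ennreal (real (Suc n) powr (\<beta> - 1) * b N))"
    using nonneg by (simp add: sum_distrib_right sum_ennreal)
  also have "\<dots> \<le> (\<Sum>n<N. ennreal (real (Suc n) powr (\<beta> - 1) * b (Suc n)))"
    using decseqD[OF \<open>decseq b\<close>] by (intro sum_mono ennreal_leI mult_left_mono) auto
  also have "\<dots> \<le> ennreal S"
    using suminf_le by (intro order_trans[OF sum_le_suminf]) auto
  finally have "(\<Sum>n<N. real (Suc n) powr (\<beta> - 1)) * b N \<le> S"
    using nonneg by (subst (asm) ennreal_le_iff) auto
  then have "2 powr (\<beta> + 1) * (\<Sum>n<N. real (Suc n) powr (\<beta> - 1)) * b N \<le> 2 powr (\<beta> + 1) * S"
    by (simp add: mult.assoc)
  then show ?thesis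
    using mult_right_mono[OF sum_powr_ge[OF \<open>0 < \<beta>\<close>, of N] nonneg(1)[of N]] by linarith
qed

section \<open>Essential range and weighted integrals\<close>

lemma AE_in_closed_of_ess_range:
  assumes [measurable]: "\<phi> \<in> borel_measurable M"
    and "closed S" and "ess_range M \<phi> \<subseteq> S"
  shows "AE \<omega> in M. \<phi> \<omega> \<in> S"
proof -
  define F where "F = {ball z \<epsilon> |z \<epsilon>. {\<omega> \<in> space M. dist (\<phi> \<omega>) z < \<epsilon>} \<in> null_sets M}"
  have "\<And>U. U \<in> F \<Longrightarrow> open U"
    by (auto simp: F_def)
  then obtain F' where F': "F' \<subseteq> F" "countable F'" "\<Union>F' = \<Union>F"
    by (rule Lindelof)
  have avoid: "AE \<omega> in M. \<phi> \<omega> \<notin> U" if U_mem: "U \<in> F'" for U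
  proof -
    obtain z \<epsilon> where U_eq: "U = ball z \<epsilon>" and null: "{\<omega> \<in> space M. dist (\<phi> \<omega>) z < \<epsilon>} \<in> null_sets M"
      using U_mem \<open>F' \<subseteq> F\<close> unfolding F_def by blast
    show ?thesis
      by (rule AE_I'[OF null]) (auto simp: U_eq dist_commute)
  qed
  have "- S \<subseteq> \<Union>F"
  proof
    fix z assume "z \<in> - S"
    then have "z \<notin> ess_range M \<phi>" using assms by auto
    then obtain \<epsilon> where "\<epsilon> > 0" "\<not> emeasure M {\<omega> \<in> space M. dist (\<phi> \<omega>) z < \<epsilon>} > 0"
      by (auto simp: ess_range_def)
    then have "{\<omega> \<in> space M. dist (\<phi> \<omega>) z < \<epsilon>} \<in> null_sets M"
      by (intro null_setsI) (auto simp: not_less)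
    then show "z \<in> \<Union>F"
      using \<open>\<epsilon> > 0\<close> by (auto simp: F_def intro!: exI[of _ "ball z \<epsilon>"])
  qed
  then have cover: "- S \<subseteq> \<Union>F'" using F' by simp
  have "AE \<omega> in M. \<forall>U\<in>F'. \<phi> \<omega> \<notin> U"
    using F'(2) avoid by (simp add: AE_ball_countable)
  then show ?thesis
    by eventually_elim (use cover in auto)
qed

lemma integrable_norm_powr_mult:
  fixes m :: "'a \<Rightarrow> 'b::{real_normed_vector, second_countable_topology}" and f :: "'a \<Rightarrow> real"
  assumes [measurable]: "m \<in> borel_measurable M" and bounded: "AE \<omega> in M. norm (m \<omega>) \<le> B"
    and f_int: "integrable M f" and "0 \<le> r"
  shows "integrable M (\<lambda>\<omega>. norm (m \<omega>) powr r * f \<omega>)"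
proof (rule Bochner_Integration.integrable_bound)
  show "integrable M (\<lambda>\<omega>. B powr r * f \<omega>)"
    using f_int by simp
  show "AE \<omega> in M. norm (norm (m \<omega>) powr r * f \<omega>) \<le> norm (B powr r * f \<omega>)"
    using bounded by eventually_elim
      (use \<open>0 \<le> r\<close> in \<open>auto simp: abs_mult intro!: mult_right_mono powr_mono2\<close>)
qed (use f_int in measurable)

lemma Youngs_inequality_scaled:
  fixes x a s :: real
  assumes "0 \<le> x" "0 < a" "1 \<le> s"
  shows "x \<le> a powr (1 / s) * (1 / s / a * x powr s + (1 - 1 / s))"
proof (cases "x = 0")
  case False
  then have "(x powr s / a) powr (1 / s) * 1 powr (1 - 1 / s) \<le> 1 / s * (x powr s / a) + (1 - 1 / s) * 1"
    using assms by (intro Youngs_inequality_0) auto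
  then show ?thesis
    using assms by (simp add: powr_divide powr_powr divide_le_eq mult.commute)
qed (use assms in auto)

lemma integral_mult_le_Young:
  fixes f g :: "'a \<Rightarrow> real"
  assumes "0 < a" "1 \<le> s" and f_nonneg: "\<And>\<omega>. 0 \<le> f \<omega>" and g_nonneg: "\<And>\<omega>. 0 \<le> g \<omega>"
    and f_int: "integrable M f" and gsf_int: "integrable M (\<lambda>\<omega>. g \<omega> powr s * f \<omega>)"
  shows "(\<integral>\<omega>. g \<omega> * f \<omega> \<partial>M)
    \<le> a powr (1 / s) * (1 / s / a * (\<integral>\<omega>. g \<omega> powr s * f \<omega> \<partial>M) + (1 - 1 / s) * (\<integral>\<omega>. f \<omega> \<partial>M))"
proof -
  have "(\<integral>\<omega>. g \<omega> * f \<omega> \<partial>M)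
      \<le> (\<integral>\<omega>. a powr (1 / s) * (1 / s / a * (g \<omega> powr s * f \<omega>) + (1 - 1 / s) * f \<omega>) \<partial>M)"
  proof (rule integral_mono')
    fix \<omega>
    show "g \<omega> * f \<omega> \<le> a powr (1 / s) * (1 / s / a * (g \<omega> powr s * f \<omega>) + (1 - 1 / s) * f \<omega>)"
      using mult_right_mono[OF Youngs_inequality_scaled[OF g_nonneg \<open>0 < a\<close> \<open>1 \<le> s\<close>] f_nonneg, of \<omega> \<omega>]
      by (simp add: algebra_simps)
    show "0 \<le> a powr (1 / s) * (1 / s / a * (g \<omega> powr s * f \<omega>) + (1 - 1 / s) * f \<omega>)"
      using \<open>0 < a\<close> \<open>1 \<le> s\<close> f_nonneg by (intro mult_nonneg_nonneg add_nonneg_nonneg) auto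
  qed (use f_int gsf_int in auto)
  then show ?thesis
    using f_int gsf_int by simp
qed

text \<open>Jensen's inequality for \<open>t powr s\<close> and the measure with density \<open>f\<close>.\<close>

lemma integral_mult_powr_le:
  fixes f g :: "'a \<Rightarrow> real"
  assumes "1 \<le> s" and f_nonneg: "\<And>\<omega>. 0 \<le> f \<omega>" and g_nonneg: "\<And>\<omega>. 0 \<le> g \<omega>"
    and [measurable]: "g \<in> borel_measurable M"
    and f_int: "integrable M f" and gsf_int: "integrable M (\<lambda>\<omega>. g \<omega> powr s * f \<omega>)"
  shows "(\<integral>\<omega>. g \<omega> * f \<omega> \<partial>M) powr s
    \<le> (\<integral>\<omega>. f \<omega> \<partial>M) powr (s - 1) * (\<integral>\<omega>. g \<omega> powr s * f \<omega> \<partial>M)"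
proof -
  define F where "F = (\<integral>\<omega>. f \<omega> \<partial>M)"
  define G where "G = (\<integral>\<omega>. g \<omega> powr s * f \<omega> \<partial>M)"
  have nonneg: "0 \<le> F" "0 \<le> G" "0 \<le> (\<integral>\<omega>. g \<omega> * f \<omega> \<partial>M)"
    unfolding F_def G_def using f_nonneg g_nonneg by (auto intro!: Bochner_Integration.integral_nonneg)
  have [measurable]: "f \<in> borel_measurable M"
    using f_int by simp
  consider (degenerate) "F = 0 \<or> G = 0" | (positive) "F > 0" "G > 0"
    using nonneg by linarith
  then have "(\<integral>\<omega>. g \<omega> * f \<omega> \<partial>M) powr s \<le> F powr (s - 1) * G"
  proof cases
    case degenerate
    then have "AE \<omega> in M. f \<omega> = 0 \<or> g \<omega> powr s * f \<omega> = 0"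
      using integral_nonneg_eq_0_iff_AE[OF f_int] integral_nonneg_eq_0_iff_AE[OF gsf_int] f_nonneg
      by (auto simp: F_def G_def elim: eventually_mono)
    then have "AE \<omega> in M. g \<omega> * f \<omega> = 0"
      by eventually_elim auto
    then have "(\<integral>\<omega>. g \<omega> * f \<omega> \<partial>M) = (\<integral>\<omega>. 0 \<partial>M)"
      by (intro integral_cong_AE) auto
    then show ?thesis
      using nonneg by simp
  next
    case positive
    then have "(\<integral>\<omega>. g \<omega> * f \<omega> \<partial>M) \<le> (G / F) powr (1 / s) * (1 / s / (G / F) * G + (1 - 1 / s) * F)"
      unfolding F_def G_def using assms by (intro integral_mult_le_Young) auto
    also have "1 / s / (G / F) * G + (1 - 1 / s) * F = F"
      using positive \<open>1 \<le> s\<close> by (simp add: field_simps)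
    finally have "(\<integral>\<omega>. g \<omega> * f \<omega> \<partial>M) powr s \<le> ((G / F) powr (1 / s) * F) powr s"
      using nonneg \<open>1 \<le> s\<close> by (intro powr_mono2) auto
    also have "\<dots> = F powr (s - 1) * G"
      using positive \<open>1 \<le> s\<close> by (simp add: powr_mult powr_powr powr_diff)
    finally show ?thesis .
  qed
  then show ?thesis
    by (simp only: F_def G_def)
qed

section \<open>Multiplication operators on \<open>L\<^sup>q\<close>\<close>

lemma Lq_norm_nonneg: "0 \<le> Lq_norm M q f"
  by (simp add: Lq_norm_def)

lemma Lq_norm_powr:
  assumes "q > 0"
  shows "Lq_norm M q f powr p = (\<integral>\<omega>. norm (f \<omega>) powr q \<partial>M) powr (p / q)"
  using assms by (simp add: Lq_norm_def powr_powr)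

lemma Lq_norm_mono:
  assumes "q > 0" and "f \<in> Lq_space M q" "g \<in> Lq_space M q"
    and norm_le: "AE \<omega> in M. norm (f \<omega>) \<le> norm (g \<omega>)"
  shows "Lq_norm M q f \<le> Lq_norm M q g"
proof -
  have "(\<integral>\<omega>. norm (f \<omega>) powr q \<partial>M) \<le> (\<integral>\<omega>. norm (g \<omega>) powr q \<partial>M)"
  proof (rule integral_mono_AE)
    show "AE \<omega> in M. norm (f \<omega>) powr q \<le> norm (g \<omega>) powr q"
      using norm_le by eventually_elim (use assms in \<open>auto intro!: powr_mono2\<close>)
  qed (use assms in \<open>auto simp: Lq_space_def\<close>)
  then show ?thesis
    unfolding Lq_norm_def using assms by (intro powr_mono2) auto
qed

lemma norm_mult_op_powr: "norm (mult_op m f \<omega>) powr q = norm (m \<omega>) powr q * norm (f \<omega>) powr q"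
  by (simp add: mult_op_def norm_mult powr_mult)

lemma mult_op_in_Lq_space:
  assumes m: "m \<in> borel_measurable M" "AE \<omega> in M. norm (m \<omega>) \<le> B"
    and "0 \<le> q" and f: "f \<in> Lq_space M q"
  shows "mult_op m f \<in> Lq_space M q"
proof -
  have "mult_op m f \<in> borel_measurable M"
    using m(1) f by (auto simp: Lq_space_def mult_op_def[abs_def])
  then show ?thesis
    using integrable_norm_powr_mult[OF m _ \<open>0 \<le> q\<close>] f by (simp add: Lq_space_def norm_mult_op_powr)
qed

lemma Lq_norm_mult_op_const:
  assumes "q > 0"
  shows "Lq_norm M q (mult_op (\<lambda>_. c) f) = norm c * Lq_norm M q f"
  using assms by (simp add: Lq_norm_def norm_mult_op_powr powr_mult powr_powr)

lemma Lq_norm_mult_op_le: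
  assumes m: "m \<in> borel_measurable M" "AE \<omega> in M. norm (m \<omega>) \<le> B"
    and "0 \<le> B" and "q > 0" and f: "f \<in> Lq_space M q"
  shows "Lq_norm M q (mult_op m f) \<le> B * Lq_norm M q f"
proof -
  have "Lq_norm M q (mult_op m f) \<le> Lq_norm M q (mult_op (\<lambda>_. complex_of_real B) f)"
  proof (rule Lq_norm_mono)
    show "AE \<omega> in M. norm (mult_op m f \<omega>) \<le> norm (mult_op (\<lambda>_. complex_of_real B) f \<omega>)"
      using m(2) by eventually_elim
        (use \<open>0 \<le> B\<close> in \<open>auto simp: mult_op_def norm_mult intro!: mult_right_mono\<close>)
  qed (use assms in \<open>auto intro!: mult_op_in_Lq_space\<close>)
  then show ?thesis
    using assms by (simp add: Lq_norm_mult_op_const)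
qed

lemma integral_norm_powr_mult_le_of_Lq_norm_mult_op_le:
  assumes op_le: "\<And>f. f \<in> Lq_space M q \<Longrightarrow> Lq_norm M q (mult_op m f) \<le> K * Lq_norm M q f"
    and "q > 0" and h: "integrable M h" "\<And>\<omega>. 0 \<le> h \<omega>"
  shows "(\<integral>\<omega>. norm (m \<omega>) powr q * h \<omega> \<partial>M) \<le> K powr q * (\<integral>\<omega>. h \<omega> \<partial>M)"
proof -
  have [measurable]: "h \<in> borel_measurable M"
    using h by simp
  define f where "f = (\<lambda>\<omega>. complex_of_real (h \<omega> powr (1 / q)))"
  have f_powr: "norm (f \<omega>) powr q = h \<omega>" for \<omega>
    using h(2)[of \<omega>] \<open>q > 0\<close> by (simp add: f_def powr_powr)
  have "f \<in> borel_measurable M"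
    unfolding f_def by measurable
  then have "f \<in> Lq_space M q"
    using h by (simp add: Lq_space_def f_powr)
  then have "Lq_norm M q (mult_op m f) powr q \<le> (K * Lq_norm M q f) powr q"
    using \<open>q > 0\<close> by (intro powr_mono2 op_le Lq_norm_nonneg) auto
  then show ?thesis
    using \<open>q > 0\<close> h(2) by (simp add: powr_mult Lq_norm_powr norm_mult_op_powr f_powr)
qed

lemma AE_norm_le_of_Lq_norm_mult_op_le:
  assumes "sigma_finite_measure M" and m: "m \<in> borel_measurable M" "AE \<omega> in M. norm (m \<omega>) \<le> B"
    and "0 \<le> K" and "q > 0"
    and op_le: "\<And>f. f \<in> Lq_space M q \<Longrightarrow> Lq_norm M q (mult_op m f) \<le> K * Lq_norm M q f"
  shows "AE \<omega> in M. norm (m \<omega>) \<le> K"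
proof -
  interpret sigma_finite_measure M by fact
  obtain h :: "'a \<Rightarrow> real" where h: "\<And>\<omega>. h \<omega> > 0" "integrable M h"
    using obtain_positive_integrable_function by metis
  have "AE \<omega> in M. 0 \<le> K powr q * h \<omega> - norm (m \<omega>) powr q * h \<omega>"
  proof (rule density_nonneg)
    show "integrable M (\<lambda>\<omega>. K powr q * h \<omega> - norm (m \<omega>) powr q * h \<omega>)"
      using h integrable_norm_powr_mult[OF m h(2), of q] \<open>q > 0\<close> by auto
    fix A assume A: "A \<in> sets M"
    have hA: "integrable M (\<lambda>\<omega>. indicator A \<omega> * h \<omega>)"
      using integrable_mult_indicator[OF A h(2)] by simp
    have "(LINT \<omega>:A|M. K powr q * h \<omega> - norm (m \<omega>) powr q * h \<omega>)
        = (\<integral>\<omega>. K powr q * (indicator A \<omega> * h \<omega>) - norm (m \<omega>) powr q * (indicator A \<omega> * h \<omega>) \<partial>M)"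
      by (simp add: set_lebesgue_integral_def algebra_simps)
    also have "\<dots> = K powr q * (\<integral>\<omega>. indicator A \<omega> * h \<omega> \<partial>M)
        - (\<integral>\<omega>. norm (m \<omega>) powr q * (indicator A \<omega> * h \<omega>) \<partial>M)"
      using hA integrable_norm_powr_mult[OF m hA, of q] \<open>q > 0\<close> by simp
    also have "\<dots> \<ge> 0"
      using integral_norm_powr_mult_le_of_Lq_norm_mult_op_le[OF op_le \<open>q > 0\<close> hA] h(1) by (simp add: less_imp_le)
    finally show "0 \<le> (LINT \<omega>:A|M. K powr q * h \<omega> - norm (m \<omega>) powr q * h \<omega>)" .
  qed
  then show ?thesis
  proof eventually_elim
    case (elim \<omega>)
    then have "norm (m \<omega>) powr q \<le> K powr q"
      using h(1)[of \<omega>] by simp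
    then show ?case
      using powr_less_mono2[OF \<open>q > 0\<close> \<open>0 \<le> K\<close>] by (meson not_less)
  qed
qed

lemma zero_in_Lq_space: "(\<lambda>_. 0) \<in> Lq_space M q"
  by (simp add: Lq_space_def)

lemma Lq_onorm_le:
  assumes "0 \<le> K" and "\<And>f. f \<in> Lq_space M q \<Longrightarrow> Lq_norm M q (S f) \<le> K * Lq_norm M q f"
  shows "Lq_onorm M q S \<le> K"
  unfolding Lq_onorm_def
proof (rule cSUP_least)
  show "Lq_space M q \<noteq> {}"
    using zero_in_Lq_space by blast
  fix f assume "f \<in> Lq_space M q"
  then show "Lq_norm M q (S f) / Lq_norm M q f \<le> K"
    using assms Lq_norm_nonneg[of M q f]
    by (cases "Lq_norm M q f = 0") (auto simp: divide_le_eq)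
qed

lemma
  fixes S :: "('a \<Rightarrow> complex) \<Rightarrow> 'a \<Rightarrow> complex"
  assumes "0 \<le> B" and op_le: "\<And>f. f \<in> Lq_space M q \<Longrightarrow> Lq_norm M q (S f) \<le> B * Lq_norm M q f"
  shows Lq_onorm_nonneg: "0 \<le> Lq_onorm M q S"
    and Lq_norm_le_onorm: "f \<in> Lq_space M q \<Longrightarrow> Lq_norm M q (S f) \<le> Lq_onorm M q S * Lq_norm M q f"
proof -
  have upper: "Lq_norm M q (S f) / Lq_norm M q f \<le> Lq_onorm M q S" if "f \<in> Lq_space M q" for f
    unfolding Lq_onorm_def
  proof (rule cSUP_upper[OF that bdd_aboveI2])
    fix f assume "f \<in> Lq_space M q"
    then show "Lq_norm M q (S f) / Lq_norm M q f \<le> B"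
      using op_le[of f] Lq_norm_nonneg[of M q f] \<open>0 \<le> B\<close>
      by (cases "Lq_norm M q f = 0") (auto simp: divide_le_eq)
  qed
  show "0 \<le> Lq_onorm M q S"
    using upper[OF zero_in_Lq_space] by (rule order_trans[rotated]) (simp add: Lq_norm_nonneg)
  assume f: "f \<in> Lq_space M q"
  show "Lq_norm M q (S f) \<le> Lq_onorm M q S * Lq_norm M q f"
  proof (cases "Lq_norm M q f = 0")
    case True
    then show ?thesis using op_le[OF f] by simp
  next
    case False
    then have "Lq_norm M q f > 0" using Lq_norm_nonneg[of M q f] by simp
    then show ?thesis using upper[OF f] by (simp add: divide_le_eq)
  qed
qed

lemma Lq_onorm_mult_op_le_iff:
  assumes "sigma_finite_measure M" "m \<in> borel_measurable M"
    and "AE \<omega> in M. norm (m \<omega>) \<le> B" "0 \<le> B" "q > 0" "0 \<le> K"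
  shows "Lq_onorm M q (mult_op m) \<le> K \<longleftrightarrow> (AE \<omega> in M. norm (m \<omega>) \<le> K)"
proof
  assume "Lq_onorm M q (mult_op m) \<le> K"
  have "Lq_norm M q (mult_op m f) \<le> K * Lq_norm M q f" if f: "f \<in> Lq_space M q" for f
  proof -
    have "Lq_norm M q (mult_op m f) \<le> Lq_onorm M q (mult_op m) * Lq_norm M q f"
      using assms f by (intro Lq_norm_le_onorm[of B] Lq_norm_mult_op_le)
    also have "\<dots> \<le> K * Lq_norm M q f"
      using \<open>Lq_onorm M q (mult_op m) \<le> K\<close> by (intro mult_right_mono Lq_norm_nonneg)
    finally show ?thesis .
  qed
  then show "AE \<omega> in M. norm (m \<omega>) \<le> K"
    using AE_norm_le_of_Lq_norm_mult_op_le assms by blast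
next
  assume "AE \<omega> in M. norm (m \<omega>) \<le> K"
  then show "Lq_onorm M q (mult_op m) \<le> K"
    using assms by (intro Lq_onorm_le Lq_norm_mult_op_le)
qed

lemma bigo_Lq_onorm_mult_op_iff:
  fixes g :: "nat \<Rightarrow> real"
  assumes "sigma_finite_measure M" "\<And>n. m n \<in> borel_measurable M"
    and "\<And>n. AE \<omega> in M. norm (m n \<omega>) \<le> B" "0 \<le> B" "q > 0" and g: "\<And>n. g n > 0"
  shows "(\<lambda>n. Lq_onorm M q (mult_op (m n))) \<in> O(g)
    \<longleftrightarrow> (\<exists>K>0. AE \<omega> in M. \<forall>n. norm (m n \<omega>) \<le> K * g n)"
proof -
  have "0 \<le> Lq_onorm M q (mult_op (m n))" for n
    using assms by (intro Lq_onorm_nonneg[of B] Lq_norm_mult_op_le)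
  then have "(\<lambda>n. Lq_onorm M q (mult_op (m n))) \<in> O(g)
      \<longleftrightarrow> (\<exists>K>0. \<forall>n. Lq_onorm M q (mult_op (m n)) \<le> K * g n)"
    using bigo_sequentially_iff[of g] g by (simp add: less_le)
  also have "\<dots> \<longleftrightarrow> (\<exists>K>0. \<forall>n. AE \<omega> in M. norm (m n \<omega>) \<le> K * g n)"
    using assms by (intro ex_cong1 conj_cong refl all_cong1 Lq_onorm_mult_op_le_iff[of M _ B])
      (auto intro: mult_nonneg_nonneg less_imp_le)
  finally show ?thesis
    by (simp add: AE_all_countable)
qed

lemma Lq_norm_mult_op_powr_le:
  assumes m: "m \<in> borel_measurable M" "AE \<omega> in M. norm (m \<omega>) \<le> B"
    and "0 < q" "q \<le> p" and x: "x \<in> Lq_space M q"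
  shows "Lq_norm M q (mult_op m x) powr p
    \<le> Lq_norm M q x powr (p - q) * (\<integral>\<omega>. norm (m \<omega>) powr p * norm (x \<omega>) powr q \<partial>M)"
proof -
  have powr_ratio: "(norm (m \<omega>) powr q) powr (p / q) = norm (m \<omega>) powr p" for \<omega>
    using \<open>0 < q\<close> by (simp add: powr_powr)
  have "(\<integral>\<omega>. norm (m \<omega>) powr q * norm (x \<omega>) powr q \<partial>M) powr (p / q)
      \<le> (\<integral>\<omega>. norm (x \<omega>) powr q \<partial>M) powr (p / q - 1)
        * (\<integral>\<omega>. (norm (m \<omega>) powr q) powr (p / q) * norm (x \<omega>) powr q \<partial>M)"
    using assms integrable_norm_powr_mult[OF m, of "\<lambda>\<omega>. norm (x \<omega>) powr q" p]
    by (intro integral_mult_powr_le) (auto simp: powr_ratio Lq_space_def)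
  moreover have "p / q - 1 = (p - q) / q"
    using \<open>0 < q\<close> by (simp add: field_simps)
  ultimately show ?thesis
    using \<open>0 < q\<close> by (simp add: powr_ratio Lq_norm_powr norm_mult_op_powr)
qed

lemma suminf_Lq_norm_mult_op_powr_le:
  assumes q: "0 < q" "q \<le> p" and "0 \<le> C"
    and m [measurable]: "\<And>n. m n \<in> borel_measurable M" and bounded: "\<And>n. AE \<omega> in M. norm (m n \<omega>) \<le> B"
    and w_nonneg: "\<And>n. 0 \<le> w n"
    and sum_bounded: "AE \<omega> in M. (\<Sum>n. ennreal (w n * norm (m n \<omega>) powr p)) \<le> ennreal C"
    and x: "x \<in> Lq_space M q"
  shows "(\<Sum>n. ennreal (w n * Lq_norm M q (mult_op (m n) x) powr p)) \<le> ennreal (C * Lq_norm M q x powr p)"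
proof -
  define f where "f = (\<lambda>\<omega>. norm (x \<omega>) powr q)"
  define X where "X = Lq_norm M q x"
  have f: "integrable M f" "\<And>\<omega>. 0 \<le> f \<omega>" and [measurable]: "f \<in> borel_measurable M"
    using x by (auto simp: Lq_space_def f_def)
  have term_le: "ennreal (w n * Lq_norm M q (mult_op (m n) x) powr p)
      \<le> ennreal (X powr (p - q)) * (\<integral>\<^sup>+\<omega>. ennreal (w n * norm (m n \<omega>) powr p) * ennreal (f \<omega>) \<partial>M)" for n
  proof -
    have int_wmf: "integrable M (\<lambda>\<omega>. w n * (norm (m n \<omega>) powr p * f \<omega>))"
      using integrable_norm_powr_mult[OF m bounded f(1), of p n] q by simp
    have "ennreal (w n * Lq_norm M q (mult_op (m n) x) powr p)
        \<le> ennreal (X powr (p - q) * (\<integral>\<omega>. w n * (norm (m n \<omega>) powr p * f \<omega>) \<partial>M))"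
      using mult_left_mono[OF Lq_norm_mult_op_powr_le[OF m bounded q x] w_nonneg[of n]]
      by (intro ennreal_leI) (simp add: f_def X_def mult.left_commute)
    also have "\<dots> = ennreal (X powr (p - q)) * (\<integral>\<^sup>+\<omega>. ennreal (w n * (norm (m n \<omega>) powr p * f \<omega>)) \<partial>M)"
      using int_wmf w_nonneg f by (subst nn_integral_eq_integral) (auto simp: ennreal_mult')
    finally show ?thesis
      using w_nonneg f by (simp add: mult.assoc flip: ennreal_mult')
  qed
  have "(\<Sum>n. ennreal (w n * Lq_norm M q (mult_op (m n) x) powr p))
      \<le> (\<Sum>n. ennreal (X powr (p - q)) * (\<integral>\<^sup>+\<omega>. ennreal (w n * norm (m n \<omega>) powr p) * ennreal (f \<omega>) \<partial>M))"
    by (intro suminf_le term_le) auto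
  also have "\<dots> = ennreal (X powr (p - q))
      * (\<integral>\<^sup>+\<omega>. (\<Sum>n. ennreal (w n * norm (m n \<omega>) powr p)) * ennreal (f \<omega>) \<partial>M)"
    by (subst ennreal_suminf_cmult, subst ennreal_suminf_multc[symmetric], subst nn_integral_suminf) auto
  also have "\<dots> \<le> ennreal (X powr (p - q)) * (\<integral>\<^sup>+\<omega>. ennreal C * ennreal (f \<omega>) \<partial>M)"
    by (intro mult_left_mono nn_integral_mono_AE)
      (use sum_bounded in \<open>auto elim!: eventually_mono intro!: mult_right_mono\<close>)
  also have "(\<integral>\<^sup>+\<omega>. ennreal C * ennreal (f \<omega>) \<partial>M) = ennreal C * ennreal (X powr q)"
    using nn_integral_eq_integral[of M f] f q by (simp add: nn_integral_cmult X_def Lq_norm_powr f_def)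
  also have "ennreal (X powr (p - q)) * (ennreal C * ennreal (X powr q)) = ennreal (C * X powr p)"
    using \<open>0 \<le> C\<close> by (simp add: mult.left_commute flip: ennreal_mult' powr_add)
  finally show ?thesis
    by (simp add: X_def)
qed

section \<open>The operators \<open>T\<^sup>n(I - T)\<close>\<close>

definition power_increment :: "('a \<Rightarrow> complex) \<Rightarrow> nat \<Rightarrow> 'a \<Rightarrow> complex" where
  "power_increment \<phi> n = (\<lambda>\<omega>. \<phi> \<omega> ^ n * (1 - \<phi> \<omega>))"

lemma mult_op_funpow_comp_diff: "(mult_op \<phi> ^^ n) \<circ> (id - mult_op \<phi>) = mult_op (power_increment \<phi> n)"
proof -
  have "(mult_op \<phi> ^^ n) f = (\<lambda>\<omega>. \<phi> \<omega> ^ n * f \<omega>)" for f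
    by (induction n) (auto simp: mult_op_def)
  then show ?thesis
    by (simp add: fun_eq_iff mult_op_def power_increment_def algebra_simps)
qed

lemma norm_power_increment: "norm (power_increment \<phi> n \<omega>) = norm (\<phi> \<omega>) ^ n * norm (1 - \<phi> \<omega>)"
  by (simp add: power_increment_def norm_mult norm_power)

lemma borel_measurable_power_increment [measurable (raw)]:
  "\<phi> \<in> borel_measurable M \<Longrightarrow> power_increment \<phi> n \<in> borel_measurable M"
  by (simp add: power_increment_def)

lemma AE_norm_power_increment_le_2:
  assumes "AE \<omega> in M. norm (\<phi> \<omega>) \<le> 1"
  shows "AE \<omega> in M. norm (power_increment \<phi> n \<omega>) \<le> 2"
  using assms
proof eventually_elim
  case (elim \<omega>)
  have "norm (1 - \<phi> \<omega>) \<le> 2"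
    using norm_triangle_ineq4[of 1 "\<phi> \<omega>"] elim by simp
  then have "norm (\<phi> \<omega>) ^ n * norm (1 - \<phi> \<omega>) \<le> 1 * 2"
    using elim by (intro mult_mono power_le_one) auto
  then show ?case
    by (simp add: norm_power_increment)
qed

lemma bigo_Lq_onorm_power_increment_iff:
  assumes "sigma_finite_measure M" "\<phi> \<in> borel_measurable M" "AE \<omega> in M. norm (\<phi> \<omega>) \<le> 1" "q > 0"
  shows "(\<lambda>n. Lq_onorm M q (mult_op (power_increment \<phi> n))) \<in> O(\<lambda>n. real n powr (- \<alpha>))
    \<longleftrightarrow> (\<exists>K>0. AE \<omega> in M. \<forall>n. norm (power_increment \<phi> n \<omega>) \<le> K * real (Suc n) powr (- \<alpha>))"
proof -
  have "(\<lambda>n. real n powr (- \<alpha>)) \<in> \<Theta>(\<lambda>n. real (Suc n) powr (- \<alpha>))"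
    by real_asymp
  then show ?thesis
    using assms AE_norm_power_increment_le_2[OF assms(3)]
      bigo_Lq_onorm_mult_op_iff[of M "power_increment \<phi>" 2 q "\<lambda>n. real (Suc n) powr (- \<alpha>)"]
    by (simp add: landau_o.big.cong_bigtheta del: of_nat_Suc)
qed

lemma decseq_Lq_norm_power_increment:
  assumes \<phi>: "\<phi> \<in> borel_measurable M" "AE \<omega> in M. norm (\<phi> \<omega>) \<le> 1"
    and "q > 0" "x \<in> Lq_space M q"
  shows "decseq (\<lambda>n. Lq_norm M q (mult_op (power_increment \<phi> n) x))"
proof (rule decseq_SucI)
  fix n
  have in_Lq: "mult_op (power_increment \<phi> n) x \<in> Lq_space M q" for n
    using assms by (intro mult_op_in_Lq_space[OF _ AE_norm_power_increment_le_2]) auto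
  have "AE \<omega> in M. norm (mult_op (power_increment \<phi> (Suc n)) x \<omega>) \<le> norm (mult_op (power_increment \<phi> n) x \<omega>)"
    using \<phi>(2) by eventually_elim
      (auto simp: mult_op_def norm_mult norm_power_increment
        intro!: mult_right_mono power_decreasing simp del: power_Suc)
  then show "Lq_norm M q (mult_op (power_increment \<phi> (Suc n)) x) \<le> Lq_norm M q (mult_op (power_increment \<phi> n) x)"
    using \<open>q > 0\<close> in_Lq by (intro Lq_norm_mono)
qed

lemma suminf_Lq_norm_power_increment_le:
  assumes \<phi>: "\<phi> \<in> borel_measurable M" "AE \<omega> in M. norm (\<phi> \<omega>) \<le> 1"
    and "1 \<le> q" "q \<le> p" "0 < \<alpha>"
    and decay: "AE \<omega> in M. \<forall>n. norm (power_increment \<phi> n \<omega>) \<le> K * real (Suc n) powr (- \<alpha>)"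
  shows "\<exists>C>0. \<forall>x\<in>Lq_space M q.
    (\<Sum>n. ennreal (real (Suc n) powr (\<alpha> * p - 1) * Lq_norm M q (mult_op (power_increment \<phi> (Suc n)) x) powr p))
    \<le> ennreal (C * Lq_norm M q x powr p)"
proof -
  define K' where "K' = max 1 (2 powr (\<alpha> + 1) * K)"
  obtain C where "C > 0" and sum_le: "\<And>r d K. \<lbrakk>0 \<le> r; r \<le> 1; 0 \<le> d; d \<le> K * (1 - r) powr \<alpha>\<rbrakk> \<Longrightarrow>
      (\<Sum>n. ennreal (real (Suc n) powr (\<alpha> * p - 1) * (r ^ Suc n * d) powr p)) \<le> ennreal (C * K powr p)"
    by (rule suminf_powr_mult_power_powr_le[of \<alpha> p]) (use assms in auto)
  have sum_bounded: "AE \<omega> in M. (\<Sum>n. ennreal (real (Suc n) powr (\<alpha> * p - 1) * norm (power_increment \<phi> (Suc n) \<omega>) powr p))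
      \<le> ennreal (C * K' powr p)"
    using \<phi>(2) decay
  proof eventually_elim
    case (elim \<omega>)
    have "norm (1 - \<phi> \<omega>) \<le> 2 powr (\<alpha> + 1) * K * (1 - norm (\<phi> \<omega>)) powr \<alpha>"
      using elim \<open>0 < \<alpha>\<close> by (intro le_powr_of_power_mult_le_powr) (auto simp: norm_power_increment)
    also have "\<dots> \<le> K' * (1 - norm (\<phi> \<omega>)) powr \<alpha>"
      by (intro mult_right_mono) (auto simp: K'_def)
    finally show ?case
      unfolding norm_power_increment using elim by (intro sum_le) auto
  qed
  show ?thesis
  proof (intro exI[of _ "C * K' powr p"] conjI ballI)
    show "C * K' powr p > 0"
      using \<open>C > 0\<close> by (simp add: K'_def)
    fix x assume x: "x \<in> Lq_space M q"
    show "(\<Sum>n. ennreal (real (Suc n) powr (\<alpha> * p - 1) * Lq_norm M q (mult_op (power_increment \<phi> (Suc n)) x) powr p))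
        \<le> ennreal (C * K' powr p * Lq_norm M q x powr p)"
      using assms \<open>C > 0\<close>
      by (intro suminf_Lq_norm_mult_op_powr_le[OF _ _ _ _ AE_norm_power_increment_le_2 _ sum_bounded x]) auto
  qed
qed

lemma Lq_onorm_power_increment_bigo:
  assumes \<phi>: "\<phi> \<in> borel_measurable M" "AE \<omega> in M. norm (\<phi> \<omega>) \<le> 1"
    and pos: "0 < q" "0 < p" "0 < \<alpha>"
    and "\<exists>C>0. \<forall>x\<in>Lq_space M q.
      (\<Sum>n. ennreal (real (Suc n) powr (\<alpha> * p - 1) * Lq_norm M q (mult_op (power_increment \<phi> (Suc n)) x) powr p))
      \<le> ennreal (C * Lq_norm M q x powr p)"
  shows "(\<lambda>n. Lq_onorm M q (mult_op (power_increment \<phi> n))) \<in> O(\<lambda>n. real n powr (- \<alpha>))"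
proof -
  obtain C where "C > 0" and sum_le: "\<And>x. x \<in> Lq_space M q \<Longrightarrow>
      (\<Sum>n. ennreal (real (Suc n) powr (\<alpha> * p - 1) * Lq_norm M q (mult_op (power_increment \<phi> (Suc n)) x) powr p))
      \<le> ennreal (C * Lq_norm M q x powr p)"
    using assms(6) by blast
  define D where "D = (2 powr (\<alpha> * p + 1) * C) powr (1 / p)"
  have norm_le: "Lq_norm M q (mult_op (power_increment \<phi> n) x) \<le> D * real n powr (- \<alpha>) * Lq_norm M q x"
    if "n > 0" and x: "x \<in> Lq_space M q" for n x
  proof -
    define a where "a n = Lq_norm M q (mult_op (power_increment \<phi> n) x)" for n
    have "decseq a" and a_nonneg: "\<And>n. 0 \<le> a n"
      unfolding a_def[abs_def] using \<phi> pos x by (auto intro: decseq_Lq_norm_power_increment Lq_norm_nonneg)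
    then have "decseq (\<lambda>n. a n powr p)"
      using \<open>0 < p\<close> by (auto simp: decseq_def intro: powr_mono2)
    then have "real n powr (\<alpha> * p) * a n powr p \<le> 2 powr (\<alpha> * p + 1) * (C * Lq_norm M q x powr p)"
      using pos \<open>C > 0\<close> sum_le[OF x] by (intro decseq_powr_mult_le_of_suminf_le) (auto simp: a_def)
    then have "(real n powr (\<alpha> * p) * a n powr p) powr (1 / p)
        \<le> (2 powr (\<alpha> * p + 1) * C * Lq_norm M q x powr p) powr (1 / p)"
      using pos \<open>C > 0\<close> by (intro powr_mono2) (auto simp: mult.assoc)
    then have "real n powr \<alpha> * a n \<le> D * Lq_norm M q x"
      using pos \<open>C > 0\<close> a_nonneg[of n] by (simp add: powr_mult powr_powr D_def Lq_norm_nonneg)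
    then show ?thesis
      using \<open>n > 0\<close> by (simp add: a_def powr_minus field_simps)
  qed
  have "Lq_onorm M q (mult_op (power_increment \<phi> n)) \<le> D * real n powr (- \<alpha>)" if "n > 0" for n
    using that norm_le by (intro Lq_onorm_le) (auto simp: D_def)
  moreover have "0 \<le> Lq_onorm M q (mult_op (power_increment \<phi> n))" for n
    using \<phi> pos
    by (intro Lq_onorm_nonneg[of 2] Lq_norm_mult_op_le AE_norm_power_increment_le_2) auto
  ultimately show ?thesis
    by (intro bigoI[of _ D]) (auto intro!: eventually_mono[OF eventually_gt_at_top[of 0]])
qed

theorem proposition6p3:
  fixes M :: "'a measure" and \<phi> :: "'a \<Rightarrow> complex" and p q \<alpha> :: real
    and T :: "('a \<Rightarrow> complex) \<Rightarrow> ('a \<Rightarrow> complex)"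
  assumes "sigma_finite_measure M"
    and "\<phi> \<in> borel_measurable M"
    and "ess_range M \<phi> \<subseteq> cball 0 1"
    and "1 \<le> q" and "q \<le> p"
    and "T = mult_op \<phi>"
    and "0 < \<alpha>" and "\<alpha> < 1"
  shows "(\<lambda>n. Lq_onorm M q ((T ^^ n) \<circ> (id - T))) \<in> O(\<lambda>n. real n powr (- \<alpha>))
    \<longleftrightarrow> (\<exists>C>0. \<forall>x\<in>Lq_space M q.
          (\<Sum>n. ennreal (real (Suc n) powr (\<alpha> * p - 1)
                    * Lq_norm M q (((T ^^ Suc n) \<circ> (id - T)) x) powr p))
          \<le> ennreal (C * Lq_norm M q x powr p))"
proof -
  have T: "(T ^^ n) \<circ> (id - T) = mult_op (power_increment \<phi> n)" for n
    using \<open>T = mult_op \<phi>\<close> by (simp add: mult_op_funpow_comp_diff)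
  have contraction: "AE \<omega> in M. norm (\<phi> \<omega>) \<le> 1"
    using AE_in_closed_of_ess_range[of \<phi> M "cball 0 1"] assms by simp
  show ?thesis
    unfolding T
  proof
    assume "(\<lambda>n. Lq_onorm M q (mult_op (power_increment \<phi> n))) \<in> O(\<lambda>n. real n powr (- \<alpha>))"
    then obtain K where "AE \<omega> in M. \<forall>n. norm (power_increment \<phi> n \<omega>) \<le> K * real (Suc n) powr (- \<alpha>)"
      using assms contraction by (auto simp: bigo_Lq_onorm_power_increment_iff)
    then show "\<exists>C>0. \<forall>x\<in>Lq_space M q.
        (\<Sum>n. ennreal (real (Suc n) powr (\<alpha> * p - 1) * Lq_norm M q (mult_op (power_increment \<phi> (Suc n)) x) powr p))
        \<le> ennreal (C * Lq_norm M q x powr p)"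
      using assms contraction by (intro suminf_Lq_norm_power_increment_le)
  next
    assume "\<exists>C>0. \<forall>x\<in>Lq_space M q.
        (\<Sum>n. ennreal (real (Suc n) powr (\<alpha> * p - 1) * Lq_norm M q (mult_op (power_increment \<phi> (Suc n)) x) powr p))
        \<le> ennreal (C * Lq_norm M q x powr p)"
    then show "(\<lambda>n. Lq_onorm M q (mult_op (power_increment \<phi> n))) \<in> O(\<lambda>n. real n powr (- \<alpha>))"
      using assms contraction by (intro Lq_onorm_power_increment_bigo) auto
  qed
qed

end
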